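(* Let $G$ be an infinite abelian pro-Lie group. Then $G$ has a quotient group which is an infinite separable metrizable group.
   Context: All topological groups are assumed to be Hausdorff. A quotient group of a topological group $G$ means $G/N$ with the quotient topology, where $N$ is a closed normal subgroup of $G$ (the case $N=\{e\}$ is allowed). A Lie group is a real finite-dimensional Lie group; the $0$-dimensional Lie groups are exactly the discrete groups (no countability assumption is made on the number of components). A topological group $G$ is a pro-Lie group if it is complete and every neighborhood of the identity contains a closed normal subgroup $N$ such that $G/N$ is a Lie group. *)

theory Defs
  imports "HOL-Analysis.Analysis" "HOL-Algebra.Coset"
begin

section \<open>Topological groups and their quotients\<close>

definition topological_group :: "('a, 'b) monoid_scheme \<Rightarrow> 'a topology \<Rightarrow> bool" where
  "topological_group G T \<longleftrightarrow>
     group G \<and> topspace T = carrier G \<and> Hausdorff_space T \<and>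
     continuous_map (prod_topology T T) T (\<lambda>(x, y). x \<otimes>\<^bsub>G\<^esub> y) \<and>
     continuous_map T T (\<lambda>x. inv\<^bsub>G\<^esub> x)"

definition final_topology :: "'a topology \<Rightarrow> ('a \<Rightarrow> 'c) \<Rightarrow> 'c topology" where
  "final_topology X q =
     topology (\<lambda>V. V \<subseteq> q ` topspace X \<and> openin X {x \<in> topspace X. q x \<in> V})"

lemma openin_final_topology:
  "openin (final_topology X q) V \<longleftrightarrow>
     V \<subseteq> q ` topspace X \<and> openin X {x \<in> topspace X. q x \<in> V}"
proof -
  let ?P = "\<lambda>V. V \<subseteq> q ` topspace X \<and> openin X {x \<in> topspace X. q x \<in> V}"
  have "?P (S \<inter> V)" if "?P S" "?P V" for S V
  proof -
    have "{x \<in> topspace X. q x \<in> S \<inter> V} =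
        {x \<in> topspace X. q x \<in> S} \<inter> {x \<in> topspace X. q x \<in> V}"
      by auto
    with that show ?thesis
      by (metis (no_types, lifting) le_infI1 openin_Int)
  qed
  moreover have "?P (\<Union>\<K>)" if "\<forall>V\<in>\<K>. ?P V" for \<K>
  proof -
    have "{x \<in> topspace X. q x \<in> \<Union>\<K>} = (\<Union>V\<in>\<K>. {x \<in> topspace X. q x \<in> V})"
      by auto
    then have "openin X {x \<in> topspace X. q x \<in> \<Union>\<K>}"
      using that by (metis (no_types, lifting) imageE openin_Union)
    with that show ?thesis
      by blast
  qed
  ultimately have "istopology ?P"
    unfolding istopology_def by blast
  then show ?thesis
    by (simp add: final_topology_def topology_inverse')
qed

lemma topspace_final_topology: "topspace (final_topology X q) = q ` topspace X"
proof (rule antisym)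
  show "topspace (final_topology X q) \<subseteq> q ` topspace X"
    using openin_final_topology[of X q "topspace (final_topology X q)"] by simp
  have "{x \<in> topspace X. q x \<in> q ` topspace X} = topspace X"
    by auto
  then show "q ` topspace X \<subseteq> topspace (final_topology X q)"
    by (intro openin_subset) (simp add: openin_final_topology)
qed

lemma quotient_map_final_topology: "quotient_map X (final_topology X q) q"
  by (simp add: quotient_map_def topspace_final_topology openin_final_topology)

definition quotient_group_topology ::
    "('a, 'b) monoid_scheme \<Rightarrow> 'a topology \<Rightarrow> 'a set \<Rightarrow> 'a set topology" where
  "quotient_group_topology G T N = final_topology T (\<lambda>x. N #>\<^bsub>G\<^esub> x)"

text \<open>Completeness refers to the left uniformity, whose basic entourages are the sets of all
  \<open>(x, y)\<close> with \<open>x\<inverse> y \<in> U\<close>, for \<open>U\<close> an open neighbourhood of the identity.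
  It is stated for arbitrary filters since the topology need not be first countable.\<close>

definition left_Cauchy_filter ::
    "('a, 'b) monoid_scheme \<Rightarrow> 'a topology \<Rightarrow> 'a filter \<Rightarrow> bool" where
  "left_Cauchy_filter G T F \<longleftrightarrow>
     F \<noteq> bot \<and> (\<forall>\<^sub>F x in F. x \<in> carrier G) \<and>
     (\<forall>U. openin T U \<and> \<one>\<^bsub>G\<^esub> \<in> U \<longrightarrow> (\<forall>\<^sub>F (x, y) in F \<times>\<^sub>F F. inv\<^bsub>G\<^esub> x \<otimes>\<^bsub>G\<^esub> y \<in> U))"

definition complete_topological_group ::
    "('a, 'b) monoid_scheme \<Rightarrow> 'a topology \<Rightarrow> bool" where
  "complete_topological_group G T \<longleftrightarrow>
     topological_group G T \<and>
     (\<forall>F. left_Cauchy_filter G T F \<longrightarrow> (\<exists>l. limitin T (\<lambda>x. x) l F))"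


section \<open>Smooth manifolds and Lie groups\<close>

text \<open>Points of $\mathbb{R}^n$ are the functions \<^typ>\<open>nat \<Rightarrow> real\<close> in the carrier of
  \<^term>\<open>Euclidean_space n\<close>, that is, those vanishing at all indices \<open>i \<ge> n\<close>; in this way \<open>n\<close> can be
  quantified. In the next definition \<open>S\<close> is meant to be open in \<^term>\<open>Euclidean_space n\<close>, and
  \<open>g\<close> is the \<open>i\<close>-th partial derivative of \<open>f\<close>.\<close>

primrec Ck_on :: "nat \<Rightarrow> nat \<Rightarrow> (nat \<Rightarrow> real) set \<Rightarrow> ((nat \<Rightarrow> real) \<Rightarrow> real) \<Rightarrow> bool" where
  "Ck_on n 0 S f \<longleftrightarrow> continuous_map (subtopology (Euclidean_space n) S) euclideanreal f"
| "Ck_on n (Suc k) S f \<longleftrightarrow>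
     continuous_map (subtopology (Euclidean_space n) S) euclideanreal f \<and>
     (\<forall>i<n. \<exists>g. (\<forall>x\<in>S. ((\<lambda>t. f (x(i := t))) has_real_derivative g x) (at (x i))) \<and>
                Ck_on n k S g)"

definition smooth_on :: "nat \<Rightarrow> (nat \<Rightarrow> real) set \<Rightarrow> ((nat \<Rightarrow> real) \<Rightarrow> real) \<Rightarrow> bool" where
  "smooth_on n S f \<longleftrightarrow> (\<forall>k. Ck_on n k S f)"

type_synonym 'a chart = "'a set \<times> ('a \<Rightarrow> nat \<Rightarrow> real)"

definition is_chart :: "nat \<Rightarrow> 'a topology \<Rightarrow> 'a chart \<Rightarrow> bool" where
  "is_chart n T = (\<lambda>(U, \<phi>).
     openin T U \<and> openin (Euclidean_space n) (\<phi> ` U) \<and>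
     homeomorphic_map (subtopology T U) (subtopology (Euclidean_space n) (\<phi> ` U)) \<phi>)"

text \<open>The coordinate expression of \<open>f\<close> in the charts \<open>(U, \<phi>)\<close> and \<open>(V, \<psi>)\<close> is smooth, component by
  component, where it is defined. With \<open>f\<close> the identity this is smoothness of the change of
  coordinates.\<close>

definition smooth_in_charts ::
    "nat \<Rightarrow> nat \<Rightarrow> 'a chart \<Rightarrow> 'c chart \<Rightarrow> ('a \<Rightarrow> 'c) \<Rightarrow> bool" where
  "smooth_in_charts m n = (\<lambda>(U, \<phi>) (V, \<psi>) f.
     \<forall>i<n. smooth_on m (\<phi> ` {x \<in> U. f x \<in> V}) (\<lambda>p. \<psi> (f (inv_into U \<phi> p)) i))"

definition smooth_atlas :: "nat \<Rightarrow> 'a topology \<Rightarrow> 'a chart set \<Rightarrow> bool" where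
  "smooth_atlas n T A \<longleftrightarrow>
     (\<forall>c\<in>A. is_chart n T c) \<and> (\<Union>c\<in>A. fst c) = topspace T \<and>
     (\<forall>c\<in>A. \<forall>d\<in>A. smooth_in_charts n n c d (\<lambda>x. x))"

definition smooth_map ::
    "nat \<Rightarrow> 'a topology \<Rightarrow> 'a chart set \<Rightarrow> nat \<Rightarrow> 'c topology \<Rightarrow> 'c chart set \<Rightarrow> ('a \<Rightarrow> 'c) \<Rightarrow> bool" where
  "smooth_map m S A n T B f \<longleftrightarrow>
     continuous_map S T f \<and> (\<forall>c\<in>A. \<forall>d\<in>B. smooth_in_charts m n c d f)"

text \<open>The second block of coordinates is shifted by \<open>m\<close>, identifying
  $\mathbb{R}^m \times \mathbb{R}^n$ with $\mathbb{R}^{m+n}$.\<close>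

definition prod_chart :: "nat \<Rightarrow> 'a chart \<Rightarrow> 'c chart \<Rightarrow> ('a \<times> 'c) chart" where
  "prod_chart m = (\<lambda>(U, \<phi>) (V, \<psi>).
     (U \<times> V, \<lambda>(x, y) i. if i < m then \<phi> x i else \<psi> y (i - m)))"

definition prod_atlas :: "nat \<Rightarrow> 'a chart set \<Rightarrow> 'c chart set \<Rightarrow> ('a \<times> 'c) chart set" where
  "prod_atlas m A B = {prod_chart m c d | c d. c \<in> A \<and> d \<in> B}"

text \<open>A single dimension \<open>n\<close> suffices because topological groups are homogeneous. There is
  no countability condition, so that every discrete group is a Lie group of dimension 0.\<close>

definition Lie_group :: "('a, 'b) monoid_scheme \<Rightarrow> 'a topology \<Rightarrow> bool" where
  "Lie_group G T \<longleftrightarrow>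
     topological_group G T \<and>
     (\<exists>n A. smooth_atlas n T A \<and>
        smooth_map (n + n) (prod_topology T T) (prod_atlas n A A) n T A (\<lambda>(x, y). x \<otimes>\<^bsub>G\<^esub> y) \<and>
        smooth_map n T A n T A (\<lambda>x. inv\<^bsub>G\<^esub> x))"


section \<open>Pro-Lie groups\<close>

definition pro_Lie_group :: "('a, 'b) monoid_scheme \<Rightarrow> 'a topology \<Rightarrow> bool" where
  "pro_Lie_group G T \<longleftrightarrow>
     complete_topological_group G T \<and>
     (\<forall>U. openin T U \<and> \<one>\<^bsub>G\<^esub> \<in> U \<longrightarrow>
        (\<exists>N. N \<subseteq> U \<and> N \<lhd> G \<and> closedin T N \<and>
             Lie_group (G Mod N) (quotient_group_topology G T N)))"

end

theory Submission
  imports Defs "HOL-Algebra.Generated_Groups" "HOL-Computational_Algebra.Primes"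
begin

text \<open>If some Lie quotient \<open>L\<close> of \<open>G\<close> is infinite, only the local second countability of \<open>L\<close> matters: \<open>L\<close> has
  an open subgroup \<open>H\<close> that is the closure of a countable subgroup. If \<open>H\<close> has finite index, \<open>L\<close> is
  second countable, hence separable, and metrizable by Urysohn's theorem. Otherwise \<open>L/H\<close> is an infinite
  discrete abelian group, which has a countably infinite quotient, and this is a discrete quotient
  of \<open>G\<close>.

  If all Lie quotients are finite, \<open>G\<close> has a base at the identity of open subgroups of finite index, so
  completeness makes it compact. The quotient by the intersection of a strictly decreasing sequence
  of such subgroups is infinite, compact, Hausdorff and second countable.\<close>

section \<open>Ultrafilters and metrization\<close>

text \<open>Zorn's lemma for the reversed order yields a minimal proper filter \<open>U\<close>
  below \<open>F\<close>. If the complement of \<open>P\<close> is not eventual in \<open>U\<close>,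
  adjoining \<open>P\<close> keeps the filter proper, so by minimality it changes nothing.\<close>

lemma exists_ultrafilter:
  fixes F :: "'a filter"
  assumes "F \<noteq> bot"
  obtains U where "U \<le> F" "U \<noteq> bot" "\<And>P. eventually P U \<or> eventually (\<lambda>x. \<not> P x) U"
proof -
  define A where "A = {U. U \<noteq> bot \<and> U \<le> F}"
  have "\<exists>m\<in>A. \<forall>a\<in>A. a \<le> m \<longrightarrow> a = m"
  proof (rule predicate_Zorn[where P = "\<lambda>x y. y \<le> x"])
    show "partial_order_on A (relation_of (\<lambda>x y. y \<le> x) A)"
      by (rule partial_order_on_relation_ofI) auto
    fix C assume C: "C \<in> Chains (relation_of (\<lambda>x y. y \<le> x) A)"
    have CA: "C \<subseteq> A" and tot: "\<And>a b. a \<in> C \<Longrightarrow> b \<in> C \<Longrightarrow> a \<le> b \<or> b \<le> a"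
      using C by (auto simp: Chains_def relation_of_def)
    show "\<exists>u\<in>A. \<forall>a\<in>C. u \<le> a"
    proof (cases "C = {}")
      case True
      then show ?thesis using assms by (auto simp: A_def)
    next
      case False
      \<comment> \<open>A chain is directed downwards, so an event holds eventually in
        \<open>Inf C\<close> only if it does so in some member; all members being proper,
        \<open>Inf C\<close> is proper.\<close>
      have "\<exists>x\<in>C. x \<le> inf a b" if "a \<in> C" "b \<in> C" for a b
        using tot[OF that] that by (metis inf.orderE inf.commute order_refl)
      then have "eventually P (Inf C) \<longleftrightarrow> (\<exists>b\<in>C. eventually P b)" for P
        by (intro eventually_Inf_base[OF False])
      then have "Inf C \<noteq> bot"
        using CA by (auto simp: trivial_limit_def A_def)
      moreover have "Inf C \<le> F"
        using False CA by (auto simp: A_def intro: Inf_lower2)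
      ultimately show ?thesis
        by (intro bexI[of _ "Inf C"]) (auto simp: A_def Inf_lower)
    qed
  qed
  then obtain U where U: "U \<noteq> bot" "U \<le> F" and mx: "\<And>V. V \<noteq> bot \<Longrightarrow> V \<le> F \<Longrightarrow> V \<le> U \<Longrightarrow> V = U"
    by (auto simp: A_def)
  have "eventually P U" if "\<not> eventually (\<lambda>x. \<not> P x) U" for P
  proof -
    have "inf U (principal {x. P x}) \<noteq> bot"
      using that by (simp add: trivial_limit_def eventually_inf_principal)
    then have "inf U (principal {x. P x}) = U"
      using U by (intro mx) (auto intro: le_infI1)
    then show ?thesis
      by (metis inf.orderI le_principal mem_Collect_eq eventually_mono)
  qed
  with U that show thesis by blast
qed

text \<open>Countably many Urysohn functions, one for each suitable pair of base sets, separate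
  points from closed sets and so embed \<open>X\<close> into a countable power of the real line,
  which is metrizable.\<close>

lemma Urysohn_metrization:
  assumes reg: "regular_space X" and haus: "Hausdorff_space X" and sc: "second_countable X"
  shows "metrizable_space X"
proof (cases "topspace X = {}")
  case True
  then show ?thesis
    by (metis null_topspace_iff_trivial empty_metrizable_space)
next
  case False
  obtain B where B: "countable B" "\<And>V. V \<in> B \<Longrightarrow> openin X V"
    and base: "\<And>U x. openin X U \<Longrightarrow> x \<in> U \<Longrightarrow> \<exists>V\<in>B. x \<in> V \<and> V \<subseteq> U"
    using sc unfolding second_countable_def by metis
  have norm: "normal_space X"
    using regular_second_countable_imp_hereditarily_normal_space[of X] reg sc hereditarily_inc by blast
  \<comment> \<open>The function attached to \<open>(V, W)\<close> will vanish on the closure of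
    \<open>V\<close> and be 1 outside \<open>W\<close>.\<close>
  define I where "I = {(V, W). V \<in> B \<and> W \<in> B \<and> X closure_of V \<subseteq> W}"
  have "I \<subseteq> B \<times> B" by (auto simp: I_def)
  then have cI: "countable I"
    using B(1) by (meson countable_SIGMA countable_subset)
  have "\<exists>f. continuous_map X euclideanreal f \<and> f ` (X closure_of fst p) \<subseteq> {0::real} \<and>
        f ` (topspace X - snd p) \<subseteq> {1}" if "p \<in> I" for p
  proof -
    have "closedin X (X closure_of fst p)" "closedin X (topspace X - snd p)"
      "disjnt (X closure_of fst p) (topspace X - snd p)"
      using that B(2) by (auto simp: I_def disjnt_iff)
    then show ?thesis
      using Urysohn_lemma_alt[OF norm] by metis
  qed
  then obtain f where f: "\<And>p. p \<in> I \<Longrightarrow> continuous_map X euclideanreal (f p)"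
    and f0: "\<And>p. p \<in> I \<Longrightarrow> f p ` (X closure_of fst p) \<subseteq> {0::real}"
    and f1: "\<And>p. p \<in> I \<Longrightarrow> f p ` (topspace X - snd p) \<subseteq> {1}"
    by metis
  \<comment> \<open>Regularity puts a closed neighbourhood of \<open>x\<close> inside a base set
    \<open>W\<close> contained in \<open>U\<close>; a base set \<open>V\<close> around
    \<open>x\<close> in that neighbourhood has its closure in \<open>W\<close>, so
    \<open>(V, W)\<close> is an admissible index.\<close>
  have sep: "\<exists>p\<in>I. f p x = 0 \<and> (\<forall>y\<in>topspace X - U. f p y = 1)"
    if U: "openin X U" "x \<in> U" for U x
  proof -
    obtain W where W: "W \<in> B" "x \<in> W" "W \<subseteq> U" using base[OF U] by blast
    then obtain O' C where O': "openin X O'" "closedin X C" "x \<in> O'" "O' \<subseteq> C" "C \<subseteq> W"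
      using reg[folded neighbourhood_base_of_closedin] B(2)
      unfolding neighbourhood_base_of by metis
    then obtain V where V: "V \<in> B" "x \<in> V" "V \<subseteq> O'" using base by blast
    have cl: "X closure_of V \<subseteq> W"
      using V O' by (meson closure_of_minimal order_trans)
    have "x \<in> X closure_of V"
      using V B(2) by (meson closure_of_subset openin_subset subsetD)
    with V W cl show ?thesis
      using f0[of "(V, W)"] f1[of "(V, W)"]
      by (intro bexI[of _ "(V, W)"]) (auto simp: I_def image_subset_iff)
  qed
  define P where "P = product_topology (\<lambda>p::'a set \<times> 'a set. euclideanreal) I"
  define e where "e = (\<lambda>x. \<lambda>p\<in>I. f p x)"
  have e_cont: "continuous_map X P e"
    unfolding P_def e_def continuous_map_componentwise using f
    by (auto simp: extensional_def)
  have "metrizable_space P"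
    unfolding P_def
    using cI by (intro metrizable_topology_D metrizable_space_euclidean)
      (auto intro: countable_subset[OF _ cI])
  moreover have "homeomorphic_map X (subtopology P (e ` topspace X)) e"
  proof (rule bijective_open_imp_homeomorphic_map)
    show "continuous_map X (subtopology P (e ` topspace X)) e"
      using e_cont by (auto simp: continuous_map_in_subtopology)
    have sub: "e ` topspace X \<subseteq> topspace P"
      using e_cont continuous_map_image_subset_topspace by blast
    then show "e ` topspace X = topspace (subtopology P (e ` topspace X))"
      by (auto simp: topspace_subtopology)
    show "inj_on e (topspace X)"
    proof (rule inj_onI, rule ccontr)
      fix x y assume xy: "x \<in> topspace X" "y \<in> topspace X" "e x = e y" "x \<noteq> y"
      have "openin X (topspace X - {y})"
        using haus xy by (meson closedin_Hausdorff_singleton openin_diff openin_topspace)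
      then obtain p where "p \<in> I" "f p x = 0" "f p y = 1"
        using sep[of "topspace X - {y}" x] xy by auto
      then show False
        using fun_cong[OF xy(3), of p] by (simp add: e_def)
    qed
    show "open_map X (subtopology P (e ` topspace X)) e"
      unfolding open_map_def
    proof (intro allI impI)
      fix U assume U: "openin X U"
      have "\<exists>T. openin (subtopology P (e ` topspace X)) T \<and> e x \<in> T \<and> T \<subseteq> e ` U" if x: "x \<in> U" for x
      proof -
        obtain p where p: "p \<in> I" "f p x = 0" "\<And>y. y \<in> topspace X - U \<Longrightarrow> f p y = 1"
          using sep[OF U x] by blast
        have xX: "x \<in> topspace X" using U x openin_subset by blast
        have "continuous_map P euclideanreal (\<lambda>z. z p)"
          unfolding P_def using p by (intro continuous_map_product_projection)
        then have "openin P {z \<in> topspace P. z p \<in> {..<1}}"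
          by (rule openin_continuous_map_preimage) auto
        then have "openin (subtopology P (e ` topspace X)) (e ` topspace X \<inter> {z \<in> topspace P. z p \<in> {..<1}})"
          by (rule openin_subtopology_Int2)
        moreover have "e x p = 0" "e x \<in> topspace P"
          using p xX sub by (auto simp: e_def)
        moreover have "e y \<in> e ` U" if "y \<in> topspace X" "e y p < 1" for y
          using p that by (force simp: e_def)
        ultimately show ?thesis
          using xX by (intro exI[of _ "e ` topspace X \<inter> {z \<in> topspace P. z p \<in> {..<1}}"]) auto
      qed
      then show "openin (subtopology P (e ` topspace X)) (e ` U)"
        by (subst openin_subopen) blast
    qed
  qed
  ultimately show ?thesis
    by (meson homeomorphic_map_imp_homeomorphic_space homeomorphic_metrizable_space metrizable_space_subtopology)
qed

lemma second_countable_Euclidean_space: "second_countable (Euclidean_space n)"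
proof -
  obtain B :: "(nat \<Rightarrow> real) set set" where "countable B" "\<And>C. C \<in> B \<Longrightarrow> open C"
    "\<And>S. open S \<Longrightarrow> \<exists>U. U \<subseteq> B \<and> S = \<Union>U"
    using univ_second_countable by metis
  then have "second_countable (euclidean :: (nat \<Rightarrow> real) topology)"
    unfolding second_countable_def open_openin[symmetric]
    by (intro exI[of _ B]) (metis Union_iff Union_upper subset_iff)
  then show ?thesis
    by (simp add: Euclidean_space_def euclidean_product_topology second_countable_subtopology)
qed

section \<open>Countable quotients of abelian groups\<close>

text \<open>Every element of the generated subgroup is the product of a finite list of generators
  and their inverses, and a countable alphabet has only countably many lists.\<close>

lemma (in group) countable_generate:
  assumes "countable S" "S \<subseteq> carrier G"
  shows "countable (generate G S)"
proof -
  define S' where "S' = S \<union> m_inv G ` S"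
  define ev where "ev = (\<lambda>xs. foldr (\<otimes>) xs \<one>)"
  have S': "countable S'" "S' \<subseteq> carrier G"
    using assms by (auto simp: S'_def)
  have ev_closed: "ev xs \<in> carrier G" if "xs \<in> lists S'" for xs
    using that S' by (induction xs) (auto simp: ev_def)
  have ev_append: "ev (xs @ ys) = ev xs \<otimes> ev ys" if "xs \<in> lists S'" "ys \<in> lists S'" for xs ys
    using that
  proof (induction xs)
    case Nil
    then show ?case using ev_closed by (simp add: ev_def)
  next
    case (Cons x xs)
    then have "ev xs \<in> carrier G" "ev ys \<in> carrier G" "x \<in> carrier G"
      using ev_closed S' by auto
    with Cons show ?case by (auto simp: ev_def m_assoc)
  qed
  have "x \<in> ev ` lists S'" if "x \<in> generate G S" for x
    using that
  proof (induction rule: generate.induct)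
    case one
    then show ?case by (intro image_eqI[of _ _ "[]"]) (auto simp: ev_def)
  next
    case (incl h)
    then show ?case using assms by (intro image_eqI[of _ _ "[h]"]) (auto simp: ev_def S'_def)
  next
    case (inv h)
    then show ?case using assms by (intro image_eqI[of _ _ "[inv h]"]) (auto simp: ev_def S'_def)
  next
    case (eng h1 h2)
    then obtain xs ys where "xs \<in> lists S'" "ys \<in> lists S'" "h1 = ev xs" "h2 = ev ys" by auto
    then show ?case using ev_append by (intro image_eqI[of _ _ "xs @ ys"]) auto
  qed
  then show ?thesis
    using S'(1) by (meson countable_image countable_lists countable_subset subsetI)
qed

text \<open>In an abelian group two \<open>m\<close>-th roots of \<open>y\<close> differ by an
  element of the \<open>m\<close>-torsion, so a nonempty set of roots is a translate of that torsion
  subgroup.\<close>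

lemma (in comm_group) countable_nth_roots:
  fixes m :: nat
  assumes "countable {x \<in> carrier G. x [^] m = \<one>}"
  shows "countable {x \<in> carrier G. x [^] m = y}"
proof (cases "{x \<in> carrier G. x [^] m = y} = {}")
  case False
  then obtain a where a: "a \<in> carrier G" "a [^] m = y" by auto
  have "x \<in> (\<lambda>z. a \<otimes> z) ` {x \<in> carrier G. x [^] m = \<one>}"
    if x: "x \<in> carrier G" "x [^] m = y" for x
  proof (rule image_eqI[of _ _ "inv a \<otimes> x"])
    show "x = a \<otimes> (inv a \<otimes> x)"
      using a x by (simp add: m_assoc[symmetric])
    have "(inv a \<otimes> x) [^] m = inv y \<otimes> y"
      using a x by (simp add: nat_pow_distrib nat_pow_inv)
    then show "inv a \<otimes> x \<in> {x \<in> carrier G. x [^] m = \<one>}"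
      using a x by auto
  qed
  then have "{x \<in> carrier G. x [^] m = y} \<subseteq> (\<lambda>z. a \<otimes> z) ` {x \<in> carrier G. x [^] m = \<one>}"
    by auto
  then show ?thesis
    using assms countable_image countable_subset by blast
qed (metis countable_empty)

text \<open>The essentiality hypothesis puts every element of prime order into \<open>C\<close>, so the torsion subgroups
  \<open>{x. x\<^sup>m = 1}\<close> are countable by induction on the number of prime factors of \<open>m\<close>.\<close>

lemma (in comm_group) countable_essential_extension:
  assumes "countable C" "subgroup C G"
    and ess: "\<And>x. x \<in> carrier G \<Longrightarrow> x \<noteq> \<one> \<Longrightarrow> \<exists>j::nat. x [^] j \<in> C \<and> x [^] j \<noteq> \<one>"
  shows "countable (carrier G)"
proof -
  have tors: "countable {x \<in> carrier G. x [^] m = \<one>}" if "m > 0" for m :: nat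
    using that
  proof (induction m rule: less_induct)
    case (less m)
    show ?case
    proof (cases "m = 1")
      case True
      have "{x \<in> carrier G. x [^] (1::nat) = \<one>} \<subseteq> {\<one>}"
        by auto
      then have "countable {x \<in> carrier G. x [^] (1::nat) = \<one>}"
        by (rule countable_subset) simp
      then show ?thesis using True by simp
    next
      case False
      then obtain p where "prime p" "p dvd m"
        using prime_factor_nat by blast
      then obtain k where p: "prime p" "m = p * k"
        by (auto elim: dvdE)
      have k: "k > 0" "k < m"
        using less.prems p prime_gt_1_nat[OF p(1)] by auto
      have "x \<in> C" if x: "x \<in> carrier G" "x [^] p = \<one>" for x
      proof (cases "x = \<one>")
        case True
        then show ?thesis using assms(2) by (simp add: subgroup.one_closed)
      next
        case False
        then obtain j :: nat where j: "x [^] j \<in> C" "x [^] j \<noteq> \<one>"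
          using ess x by blast
        \<comment> \<open>A nontrivial power \<open>x [^] j\<close> of an element with
          \<open>x [^] p = \<one>\<close> has \<open>j\<close> prime to \<open>p\<close>; Bezout
          then recovers \<open>x\<close> as a power of \<open>x [^] j\<close>, an element of
          \<open>C\<close>.\<close>
        have "\<not> p dvd j"
          using j x by (metis dvdE nat_pow_one nat_pow_pow)
        then have "coprime j p"
          using p(1) by (metis coprime_commute prime_imp_coprime)
        then obtain u v where uv: "j * u = p * v + 1"
          using bezout_nat[of j p] j
          by (metis coprime_iff_gcd_eq_1 nat_pow_0)
        have "(x [^] j) [^] u = (x [^] p) [^] v \<otimes> x"
          using uv x(1) by (simp add: nat_pow_pow)
        then have "x = (x [^] j) [^] u"
          using x by simp
        then show ?thesis
          using j assms(2) by (metis int_pow_int subgroup_int_pow_closed)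
      qed
      then have "{x \<in> carrier G. x [^] p = \<one>} \<subseteq> C" by blast
      then have "countable {x \<in> carrier G. x [^] p = \<one>}"
        using assms(1) countable_subset by blast
      \<comment> \<open>If \<open>x [^] m = \<one>\<close> then \<open>x [^] p\<close> is one of the
        countably many elements killed by \<open>k\<close>, and each of these has only countably
        many \<open>p\<close>-th roots.\<close>
      then have "countable (\<Union>y\<in>{x \<in> carrier G. x [^] k = \<one>}. {x \<in> carrier G. x [^] p = y})"
        using less.IH[OF k(2,1)] countable_nth_roots by blast
      moreover have "{x \<in> carrier G. x [^] m = \<one>} \<subseteq>
          (\<Union>y\<in>{x \<in> carrier G. x [^] k = \<one>}. {x \<in> carrier G. x [^] p = y})"
        using p by (auto simp: nat_pow_pow)
      ultimately show ?thesis
        using countable_subset by blast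
    qed
  qed
  have "x \<in> (\<Union>m\<in>{0<..}. \<Union>y\<in>C. {x \<in> carrier G. x [^] (m::nat) = y})" if x: "x \<in> carrier G" for x
  proof -
    \<comment> \<open>For \<open>x \<noteq> \<one>\<close> the exponent from essentiality is
      positive because the power is nontrivial; for \<open>x = \<one>\<close> the exponent 1 serves.
      So every element is a root of an element of \<open>C\<close>.\<close>
    have "\<exists>j>0. x [^] (j::nat) \<in> C"
    proof (cases "x = \<one>")
      case True
      then show ?thesis using assms(2) by (intro exI[of _ 1]) (simp add: subgroup.one_closed)
    next
      case False
      then show ?thesis using ess[OF x False] by (metis gr0I nat_pow_0)
    qed
    then show ?thesis using x by auto
  qed
  moreover have "countable (\<Union>m\<in>{0<..}. \<Union>y\<in>C. {x \<in> carrier G. x [^] (m::nat) = y})"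
    using tors countable_nth_roots assms(1) by auto
  ultimately show ?thesis
    by (meson countable_subset subsetI)
qed

text \<open>Divide by a subgroup maximal among those meeting a countably infinite subgroup \<open>C\<close> trivially: the
  quotient is then an essential extension of the image of \<open>C\<close>. This replaces the usual embedding into
  the divisible hull of \<open>C\<close>.\<close>

lemma (in comm_group) countably_infinite_quotient:
  assumes "infinite (carrier G)"
  obtains K where "subgroup K G" "countable (carrier (G Mod K))" "infinite (carrier (G Mod K))"
proof -
  obtain S where S: "S \<subseteq> carrier G" "infinite S" "countable S"
    using infinite_countable_subset'[OF assms] by blast
  define C where "C = generate G S"
  have C: "subgroup C G" "countable C" "infinite C"
    using S generate_is_subgroup countable_generate generate.incl
    unfolding C_def by (auto dest: finite_subset[rotated, of "generate G S" S] intro: generate.incl)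
  define Z where "Z = {B. subgroup B G \<and> B \<inter> C = {\<one>}}"
  have one: "{\<one>} \<in> Z"
    using C triv_subgroup subgroup.one_closed by (auto simp: Z_def)
  have "\<exists>M\<in>Z. \<forall>X\<in>Z. M \<subseteq> X \<longrightarrow> X = M"
  proof (rule subset_Zorn)
    fix \<C> assume ch: "subset.chain Z \<C>"
    show "\<exists>U\<in>Z. \<forall>X\<in>\<C>. X \<subseteq> U"
    proof (cases "\<C> = {}")
      case True
      then show ?thesis using one by blast
    next
      case False
      have sub: "\<And>X. X \<in> \<C> \<Longrightarrow> subgroup X G \<and> X \<inter> C = {\<one>}"
        and tot: "\<And>X Y. X \<in> \<C> \<Longrightarrow> Y \<in> \<C> \<Longrightarrow> X \<subseteq> Y \<or> Y \<subseteq> X"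
        using ch by (auto simp: subset.chain_def Z_def)
      have "subgroup (\<Union>\<C>) G"
      proof (rule subgroupI)
        show "\<Union>\<C> \<subseteq> carrier G" using sub subgroup.subset by blast
        show "\<Union>\<C> \<noteq> {}" using False sub subgroup.one_closed by fastforce
        show "inv a \<in> \<Union>\<C>" if "a \<in> \<Union>\<C>" for a
          using that sub by (meson UnionE UnionI subgroup.m_inv_closed)
        show "a \<otimes> b \<in> \<Union>\<C>" if ab: "a \<in> \<Union>\<C>" "b \<in> \<Union>\<C>" for a b
        proof -
          obtain X where "X \<in> \<C>" "a \<in> X" "b \<in> X" using ab tot by blast
          then show ?thesis using sub by (meson UnionI subgroup.m_closed)
        qed
      qed
      moreover have "\<Union>\<C> \<inter> C = {\<one>}" using False sub by blast
      ultimately show ?thesis by (intro bexI[of _ "\<Union>\<C>"]) (auto simp: Z_def)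
    qed
  qed
  then obtain B where B: "subgroup B G" "B \<inter> C = {\<one>}"
    and mx: "\<And>X. subgroup X G \<Longrightarrow> X \<inter> C = {\<one>} \<Longrightarrow> B \<subseteq> X \<Longrightarrow> X = B"
    by (auto simp: Z_def)
  have nB: "B \<lhd> G" using B subgroup_imp_normal by blast
  then interpret B: normal B G .
  have hom: "group_hom G (G Mod B) (\<lambda>x. B #> x)"
    using nB by (simp add: group_hom_def group_hom_axioms_def B.factorgroup_is_group B.r_coset_hom_Mod is_group)
  interpret q: group_hom G "G Mod B" "\<lambda>x. B #> x" by (rule hom)
  interpret E: comm_group "G Mod B" using abelian_FactGroup[OF B(1)] .
  have q_surj: "carrier (G Mod B) = (\<lambda>x. B #> x) ` carrier G"
    by (auto simp: FactGroup_def RCOSETS_def)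
  have q_one: "B #> x = \<one>\<^bsub>G Mod B\<^esub> \<longleftrightarrow> x \<in> B" if "x \<in> carrier G" for x
    using that B by (metis coset_join1 coset_join2 one_FactGroup)
  have "countable (carrier (G Mod B))"
  proof (rule E.countable_essential_extension)
    show "countable ((\<lambda>x. B #> x) ` C)" using C by auto
    show "subgroup ((\<lambda>x. B #> x) ` C) (G Mod B)"
      using C(1) q.subgroup_img_is_subgroup by blast
    fix e assume e: "e \<in> carrier (G Mod B)" "e \<noteq> \<one>\<^bsub>G Mod B\<^esub>"
    then obtain x where x: "x \<in> carrier G" "e = B #> x" using q_surj by blast
    then have "x \<notin> B" using e(2) q_one by blast
    have e_pow: "e [^]\<^bsub>G Mod B\<^esub> j = B #> (x [^] j)" for j :: nat
      using x q.hom_nat_pow by simp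
    \<comment> \<open>\<open>X\<close> is the subgroup generated by \<open>B\<close> and
      \<open>x\<close>. It is strictly larger than \<open>B\<close>, so by maximality it meets
      \<open>C\<close> nontrivially.\<close>
    define X where "X = {b \<otimes> x [^] (i::int) | b i. b \<in> B}"
    have X: "subgroup X G"
    proof (rule subgroupI)
      show "X \<subseteq> carrier G" using x B.subset by (auto simp: X_def)
      show "X \<noteq> {}" using B.one_closed unfolding X_def by blast
      show "inv a \<in> X" if a: "a \<in> X" for a
      proof -
        obtain b and i :: int where bi: "b \<in> B" "a = b \<otimes> x [^] i" using a by (auto simp: X_def)
        then have "b \<in> carrier G" using B.subset by blast
        then have "inv a = inv b \<otimes> x [^] (-i)" using bi x
          by (simp add: inv_mult int_pow_neg)
        with bi show ?thesis unfolding X_def using B.m_inv_closed by blast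
      qed
      show "a \<otimes> a' \<in> X" if a: "a \<in> X" "a' \<in> X" for a a'
      proof -
        obtain b b' and i i' :: int
          where bi: "b \<in> B" "a = b \<otimes> x [^] i" "b' \<in> B" "a' = b' \<otimes> x [^] i'"
          using a by (auto simp: X_def)
        then have "b \<in> carrier G" "b' \<in> carrier G" using B.subset by auto
        then have "a \<otimes> a' = (b \<otimes> b') \<otimes> x [^] (i + i')" using bi x
          by (simp add: int_pow_mult m_ac)
        with bi show ?thesis unfolding X_def using B.m_closed by blast
      qed
    qed
    have "B \<subseteq> X"
    proof
      fix b assume b: "b \<in> B"
      then have "b = b \<otimes> x [^] (0::int)" using B.subset by auto
      with b show "b \<in> X" unfolding X_def by blast
    qed
    moreover have "x \<in> X"
    proof -
      have "x = \<one> \<otimes> x [^] (1::int)" using x by simp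
      then show ?thesis unfolding X_def using B.one_closed by blast
    qed
    ultimately have "X \<inter> C \<noteq> {\<one>}" using mx[OF X] \<open>x \<notin> B\<close> by blast
    then obtain c where c: "c \<in> X" "c \<in> C" "c \<noteq> \<one>"
      using X C(1) subgroup.one_closed by blast
    then obtain b and i :: int where bi: "b \<in> B" "c = b \<otimes> x [^] i" by (auto simp: X_def)
    have cG: "c \<in> carrier G" using c C(1) subgroup.subset by blast
    have bG: "b \<in> carrier G" using bi B.subset by blast
    \<comment> \<open>Modulo \<open>B\<close> the element \<open>c\<close> becomes a power of
      \<open>x\<close>, and it stays nontrivial because \<open>C\<close> meets \<open>B\<close> only
      in the identity.\<close>
    have "c \<notin> B" using c B(2) by blast
    have "B #> c = B #> x [^] i"
      using bi x bG by (metis B.subgroup_axioms coset_join2 coset_mult_assoc int_pow_closed B.subset)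
    then have i: "B #> x [^] i \<in> (\<lambda>x. B #> x) ` C" "B #> x [^] i \<noteq> \<one>\<^bsub>G Mod B\<^esub>"
      using c q_one[OF cG] \<open>c \<notin> B\<close> by auto
    show "\<exists>j::nat. e [^]\<^bsub>G Mod B\<^esub> j \<in> (\<lambda>x. B #> x) ` C \<and> e [^]\<^bsub>G Mod B\<^esub> j \<noteq> \<one>\<^bsub>G Mod B\<^esub>"
    \<comment> \<open>Essentiality asks for a natural exponent. A negative \<open>i\<close> is
      replaced by its opposite, since the image of \<open>C\<close> is closed under
      inverses.\<close>
    proof (cases i rule: int_cases2)
      case (nonneg n)
      then show ?thesis using i e_pow by (metis int_pow_int)
    next
      case (nonpos n)
      have inv: "B #> x [^] i = inv\<^bsub>G Mod B\<^esub> (e [^]\<^bsub>G Mod B\<^esub> n)"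
        using nonpos x e_pow by (simp add: int_pow_neg_int q.hom_inv)
      have mem: "e [^]\<^bsub>G Mod B\<^esub> n \<in> carrier (G Mod B)" using e by simp
      have "subgroup ((\<lambda>x. B #> x) ` C) (G Mod B)"
        using C(1) q.subgroup_img_is_subgroup by blast
      then have "e [^]\<^bsub>G Mod B\<^esub> n \<in> (\<lambda>x. B #> x) ` C"
        using i(1) inv mem by (metis q.H.inv_inv subgroup.m_inv_closed)
      moreover have "e [^]\<^bsub>G Mod B\<^esub> n \<noteq> \<one>\<^bsub>G Mod B\<^esub>"
        using i(2) inv by (metis q.H.inv_one)
      ultimately show ?thesis by blast
    qed
  qed
  moreover have "infinite (carrier (G Mod B))"
  proof -
    \<comment> \<open>The trivial intersection of \<open>B\<close> and \<open>C\<close> embeds the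
      infinite group \<open>C\<close> into the quotient.\<close>
    have "inj_on (\<lambda>x. B #> x) C"
    proof (rule inj_onI)
      fix x y assume xy: "x \<in> C" "y \<in> C" "B #> x = B #> y"
      then have G: "x \<in> carrier G" "y \<in> carrier G" using C(1) subgroup.subset by blast+
      have "x \<otimes> inv y \<in> B"
        using xy G by (metis B.subgroup_axioms B.rcos_module is_group rcos_self)
      moreover have "x \<otimes> inv y \<in> C"
        using xy C(1) by (meson subgroup.m_closed subgroup.m_inv_closed)
      ultimately have "x \<otimes> inv y = \<one>" using B(2) by blast
      then show "x = y" using G by (metis inv_equality inv_inv inv_closed)
    qed
    then have "infinite ((\<lambda>x. B #> x) ` C)" using C(3) finite_imageD by blast
    moreover have "(\<lambda>x. B #> x) ` C \<subseteq> carrier (G Mod B)"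
      using C(1) subgroup.subset q_surj by blast
    ultimately show ?thesis using infinite_super by blast
  qed
  ultimately show thesis using that B(1) by blast
qed

section \<open>Topological groups\<close>

lemma (in group) rcos_eq_iff:
  assumes "subgroup H G" "x \<in> carrier G" "y \<in> carrier G"
  shows "H #> x = H #> y \<longleftrightarrow> x \<otimes> inv y \<in> H"
proof
  assume "H #> x = H #> y"
  then have "x \<in> H #> y" using rcos_self assms by blast
  then show "x \<otimes> inv y \<in> H"
    using subgroup.rcos_module[OF assms(1) is_group assms(3,2)] by blast
next
  assume "x \<otimes> inv y \<in> H"
  then have "x \<in> H #> y"
    using subgroup.rcos_module[OF assms(1) is_group assms(3,2)] by blast
  then show "H #> x = H #> y"
    using repr_independence assms by blast
qed

section \<open>Continuity of the operations, cosets, and open and closed subgroups\<close>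

locale top_group =
  fixes G (structure) and T
  assumes topological_group: "topological_group G T"

sublocale top_group \<subseteq> group G
  using topological_group by (simp add: topological_group_def)

context top_group
begin

lemma topspace_eq [simp]: "topspace T = carrier G"
  using topological_group by (simp add: topological_group_def)

lemma Hausdorff: "Hausdorff_space T"
  using topological_group by (simp add: topological_group_def)

lemma continuous_map_mult [continuous_intros]:
  assumes "continuous_map X T f" "continuous_map X T g"
  shows "continuous_map X T (\<lambda>x. f x \<otimes> g x)"
proof -
  have "continuous_map X T ((\<lambda>(x, y). x \<otimes> y) \<circ> (\<lambda>x. (f x, g x)))"
    using assms topological_group
    by (intro continuous_map_compose[of _ "prod_topology T T"])
      (auto simp: continuous_map_paired topological_group_def)
  then show ?thesis by (simp add: o_def)
qed

lemma continuous_map_inv [continuous_intros]: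
  assumes "continuous_map X T f"
  shows "continuous_map X T (\<lambda>x. inv (f x))"
proof -
  have "continuous_map X T ((\<lambda>x. inv x) \<circ> f)"
    using assms topological_group
    by (intro continuous_map_compose) (auto simp: topological_group_def)
  then show ?thesis by (simp add: o_def)
qed

text \<open>The translate is the preimage of \<open>W\<close> under right multiplication by
  \<open>inv x\<close>.\<close>

lemma openin_r_coset:
  assumes "openin T W" "x \<in> carrier G"
  shows "openin T (W #> x)"
proof -
  have W: "W \<subseteq> carrier G" using assms openin_subset by fastforce
  have "openin T {y \<in> topspace T. y \<otimes> inv x \<in> W}"
    using assms
    by (intro openin_continuous_map_preimage[where Y = T] continuous_map_mult)
      (auto simp: continuous_map_id[unfolded id_def])
  moreover have "{y \<in> topspace T. y \<otimes> inv x \<in> W} = W #> x"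
  proof (intro equalityI subsetI)
    fix y assume "y \<in> {y \<in> topspace T. y \<otimes> inv x \<in> W}"
    moreover from this have "y = y \<otimes> inv x \<otimes> x" using assms by (simp add: m_assoc)
    ultimately show "y \<in> W #> x" unfolding r_coset_def by blast
  next
    fix y assume "y \<in> W #> x"
    then obtain w where "w \<in> W" "y = w \<otimes> x" by (auto simp: r_coset_def)
    moreover from this have "w \<in> carrier G" using W by blast
    ultimately show "y \<in> {y \<in> topspace T. y \<otimes> inv x \<in> W}" using assms by (simp add: m_assoc)
  qed
  ultimately show ?thesis by simp
qed

text \<open>The translates of \<open>W\<close> by elements of \<open>H\<close> are open, stay inside
  \<open>H\<close> and cover it.\<close>

lemma openin_subgroup:
  assumes "subgroup H G" "openin T W" "\<one> \<in> W" "W \<subseteq> H"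
  shows "openin T H"
proof (subst openin_subopen, intro ballI)
  fix h assume h: "h \<in> H"
  then have hG: "h \<in> carrier G" using assms subgroup.subset by blast
  have "W #> h \<subseteq> H"
    using assms h by (auto simp: r_coset_def subgroup.m_closed subset_iff)
  moreover have "h \<in> W #> h"
    using hG assms by (auto simp: r_coset_def intro!: bexI[of _ \<one>])
  ultimately show "\<exists>V. openin T V \<and> h \<in> V \<and> V \<subseteq> H"
    using openin_r_coset[OF assms(2) hG] by blast
qed

lemma closedin_r_coset:
  assumes "subgroup H G" "closedin T H" "x \<in> carrier G"
  shows "closedin T (H #> x)"
proof -
  have "closedin T {y \<in> topspace T. y \<otimes> inv x \<in> H}"
    using assms
    by (intro closedin_continuous_map_preimage[where Y = T] continuous_map_mult)
      (auto simp: continuous_map_id[unfolded id_def])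
  moreover have "{y \<in> topspace T. y \<otimes> inv x \<in> H} = H #> x"
    using subgroup.rcos_module[OF assms(1) is_group assms(3)]
      r_coset_subset_G[OF subgroup.subset[OF assms(1)] assms(3)] by auto
  ultimately show ?thesis by simp
qed

text \<open>Serves two arguments about the complement of \<open>H\<close>: it is a union of open
  cosets if \<open>H\<close> is open, and a finite union of closed cosets if \<open>H\<close> is
  closed of finite index.\<close>

lemma carrier_diff_subgroup:
  assumes "subgroup H G"
  shows "carrier G - H = \<Union>(rcosets H - {H})"
proof -
  have H: "H \<in> rcosets H" by (rule subgroup.subgroup_in_rcosets[OF assms is_group])
  then have "C \<inter> H = {}" if "C \<in> rcosets H" "C \<noteq> H" for C
    using pairwiseD[OF rcos_disjoint[OF assms] that(1) H that(2)] by (simp add: disjnt_def)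
  then show ?thesis
    using rcosets_part_G[OF assms] H by blast
qed

lemma closedin_open_subgroup:
  assumes "subgroup H G" "openin T H"
  shows "closedin T H"
proof -
  have "openin T (carrier G - H)"
    unfolding carrier_diff_subgroup[OF assms(1)]
    using openin_r_coset[OF assms(2)] by (auto simp: RCOSETS_def)
  then show ?thesis
    using subgroup.subset[OF assms(1)] by (simp add: closedin_def)
qed

lemma openin_finite_index_subgroup:
  assumes "subgroup H G" "closedin T H" "finite (rcosets H)"
  shows "openin T H"
proof -
  have "closedin T (carrier G - H)"
    unfolding carrier_diff_subgroup[OF assms(1)]
    using closedin_r_coset[OF assms(1,2)] assms(3)
    by (intro closedin_Union) (auto simp: RCOSETS_def)
  then have "openin T (carrier G - (carrier G - H))"
    by (metis openin_diff openin_topspace topspace_eq)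
  moreover have "carrier G - (carrier G - H) = H"
    using subgroup.subset[OF assms(1)] by blast
  ultimately show ?thesis by simp
qed

text \<open>Continuous maps send closures into closures; this is applied to inversion, and to
  multiplication on \<open>S \<times> S\<close>, whose closure is the product of the
  closures.\<close>

lemma subgroup_closure_of:
  assumes "subgroup S G"
  shows "subgroup (T closure_of S) G"
proof (rule subgroupI)
  show sub: "T closure_of S \<subseteq> carrier G"
    using closure_of_subset_topspace[of T S] by simp
  show "T closure_of S \<noteq> {}"
    using assms subgroup.one_closed[OF assms] subgroup.subset[OF assms]
      closure_of_subset[of S T] by auto
  have "(\<lambda>x. inv x) ` (T closure_of S) \<subseteq> T closure_of ((\<lambda>x. inv x) ` S)"
    using topological_group continuous_map_image_closure_subset
    unfolding topological_group_def by blast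
  also have "\<dots> \<subseteq> T closure_of S"
    using assms by (intro closure_of_mono) (auto simp: subgroup.m_inv_closed)
  finally show "inv a \<in> T closure_of S" if "a \<in> T closure_of S" for a
    using that by blast
  have "(\<lambda>(x, y). x \<otimes> y) ` (prod_topology T T closure_of (S \<times> S))
      \<subseteq> T closure_of ((\<lambda>(x, y). x \<otimes> y) ` (S \<times> S))"
    using topological_group continuous_map_image_closure_subset
    unfolding topological_group_def by blast
  also have "\<dots> \<subseteq> T closure_of S"
    using assms by (intro closure_of_mono) (auto simp: subgroup.m_closed)
  finally show "a \<otimes> b \<in> T closure_of S" if "a \<in> T closure_of S" "b \<in> T closure_of S" for a b
    using that by (auto simp: closure_of_Times)
qed

text \<open>Continuity of multiplication gives neighbourhoods \<open>A\<close>, \<open>B\<close> of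
  the identity with \<open>xAB\<close> inside \<open>W\<close>. Take \<open>U = xA\<close>. If
  \<open>y\<close> is in the closure of \<open>U\<close>, the neighbourhood of \<open>y\<close>
  formed by all \<open>z\<close> with \<open>inv z \<otimes> y \<in> B\<close> meets
  \<open>U\<close>, and for such a \<open>z\<close> in \<open>U\<close> the product
  \<open>y = z \<otimes> (inv z \<otimes> y)\<close> lies in \<open>xAB\<close>.\<close>

lemma regular: "regular_space T"
  unfolding neighbourhood_base_of_closedin[symmetric]
proof (subst neighbourhood_base_of, intro allI impI)
  fix W x assume "openin T W \<and> x \<in> W"
  then have W: "openin T W" "x \<in> W" "x \<in> carrier G"
    using openin_subset by fastforce+
  have "continuous_map (prod_topology T T) T (\<lambda>p. x \<otimes> fst p \<otimes> snd p)"
    using W by (intro continuous_map_mult continuous_map_fst continuous_map_snd) auto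
  then have "openin (prod_topology T T) {p \<in> topspace (prod_topology T T). x \<otimes> fst p \<otimes> snd p \<in> W}"
    using W(1) by (rule openin_continuous_map_preimage)
  then obtain A B where AB: "openin T A" "openin T B" "\<one> \<in> A" "\<one> \<in> B"
    and AB_W: "A \<times> B \<subseteq> {p \<in> topspace (prod_topology T T). x \<otimes> fst p \<otimes> snd p \<in> W}"
    unfolding openin_prod_topology_alt
    using W by (elim allE[of _ \<one>]) (auto dest: spec[of _ \<one>])
  have prod: "x \<otimes> a \<otimes> b \<in> W" if "a \<in> A" "b \<in> B" for a b
    using AB_W that by auto
  define U where "U = {u \<in> topspace T. inv x \<otimes> u \<in> A}"
  have U: "openin T U" unfolding U_def
    using AB W
    by (intro openin_continuous_map_preimage[where Y = T] continuous_map_mult)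
      (auto simp: continuous_map_id[unfolded id_def])
  have "T closure_of U \<subseteq> W"
  proof
    fix y assume y: "y \<in> T closure_of U"
    then have yG: "y \<in> carrier G" by (simp add: in_closure_of)
    define V where "V = {z \<in> topspace T. inv z \<otimes> y \<in> B}"
    have "openin T V" unfolding V_def
      using AB yG
      by (intro openin_continuous_map_preimage[where Y = T] continuous_map_mult continuous_map_inv)
        (auto simp: continuous_map_id[unfolded id_def])
    moreover have "y \<in> V" using yG AB by (simp add: V_def)
    ultimately have "V \<inter> U \<noteq> {}"
      using y openin_Int_closure_of_eq_empty by blast
    then obtain z where z: "z \<in> U" "z \<in> carrier G" "inv z \<otimes> y \<in> B" by (auto simp: V_def)
    have "x \<otimes> (inv x \<otimes> z) \<otimes> (inv z \<otimes> y) \<in> W"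
      using prod[of "inv x \<otimes> z" "inv z \<otimes> y"] z by (simp add: U_def)
    moreover have "x \<otimes> (inv x \<otimes> z) \<otimes> (inv z \<otimes> y) = y"
    proof -
      have "x \<otimes> (inv x \<otimes> z) = z" "z \<otimes> (inv z \<otimes> y) = y"
        using W z yG by (simp_all add: m_assoc[symmetric])
      then show ?thesis by simp
    qed
    ultimately show "y \<in> W" by simp
  qed
  moreover have "U \<subseteq> T closure_of U"
    by (intro closure_of_subset) (auto simp: U_def)
  moreover have "x \<in> U"
    using W AB by (simp add: U_def)
  ultimately show "\<exists>U C. openin T U \<and> closedin T C \<and> x \<in> U \<and> U \<subseteq> C \<and> C \<subseteq> W"
    using U closedin_closure_of by blast
qed

text \<open>The fibre of the quotient map over a coset is that coset itself, a translate of the open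
  set \<open>K\<close>, so singletons are open.\<close>

lemma discrete_quotient:
  assumes "K \<lhd> G" "openin T K"
  shows "quotient_group_topology G T K = discrete_topology (carrier (G Mod K))"
proof -
  have K: "subgroup K G" using assms(1) by (simp add: normal_imp_subgroup)
  have q: "(\<lambda>x. K #> x) ` carrier G = carrier (G Mod K)"
    by (auto simp: FactGroup_def RCOSETS_def)
  have "openin (quotient_group_topology G T K) {c}" if "c \<in> carrier (G Mod K)" for c
  proof -
    obtain x where x: "x \<in> carrier G" "c = K #> x" using \<open>c \<in> _\<close> q by auto
    have "{y \<in> topspace T. K #> y \<in> {c}} = K #> x"
    proof (intro equalityI subsetI)
      fix y assume "y \<in> {y \<in> topspace T. K #> y \<in> {c}}"
      then show "y \<in> K #> x" using x K rcos_self by fastforce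
    next
      fix y assume y: "y \<in> K #> x"
      then have "y \<in> carrier G"
        using x K by (meson r_coset_subset_G subgroup.subset subsetD)
      then show "y \<in> {y \<in> topspace T. K #> y \<in> {c}}"
        using repr_independence[OF y x(1) K] x by simp
    qed
    then show ?thesis
      using openin_r_coset[OF assms(2) x(1)] that q
      by (simp add: quotient_group_topology_def openin_final_topology)
  qed
  moreover have "topspace (quotient_group_topology G T K) = carrier (G Mod K)"
    using q by (simp add: quotient_group_topology_def topspace_final_topology)
  ultimately show ?thesis
    by (metis discrete_topology_unique)
qed

text \<open>\<open>H\<close> is the closure of the countable subgroup generated by a countable dense subset of \<open>U\<close>.\<close>

lemma open_subgroup_second_countable:
  assumes U: "openin T U" "\<one> \<in> U" "second_countable (subtopology T U)"
  obtains H where "subgroup H G" "openin T H" "countable (rcosets H) \<Longrightarrow> second_countable T"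
proof -
  have UG: "U \<subseteq> carrier G" using U openin_subset by fastforce
  obtain D where D: "countable D" "D \<subseteq> U" "subtopology T U closure_of D = U"
    using second_countable_imp_separable_space[OF U(3)] UG
    by (auto simp: separable_space_def Int_absorb1)
  define S where "S = generate G D"
  have S: "subgroup S G" "countable S" "D \<subseteq> S"
    using D UG countable_generate[of D] generate_is_subgroup[of D]
    by (auto simp: S_def generate.incl)
  define H where "H = T closure_of S"
  have H: "subgroup H G" unfolding H_def by (rule subgroup_closure_of[OF S(1)])
  \<comment> \<open>\<open>D\<close> is dense in \<open>U\<close>, so the closure of
    \<open>S\<close> contains \<open>U\<close>; a subgroup containing a neighbourhood of the
    identity is open.\<close>
  have "U \<subseteq> H"
    using D S closure_of_subtopology[of T U D] closure_of_mono[of "U \<inter> D" S T]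
    by (auto simp: H_def)
  then have H_open: "openin T H" using openin_subgroup[OF H U(1,2)] by blast
  have "second_countable T" if ctbl: "countable (rcosets H)"
  proof -
    define r where "r = (\<lambda>C. SOME x. x \<in> carrier G \<and> C = H #> x)"
    have r: "r C \<in> carrier G \<and> C = H #> r C" if "C \<in> rcosets H" for C
      unfolding r_def by (rule someI_ex) (use that in \<open>auto simp: RCOSETS_def\<close>)
    \<comment> \<open>\<open>S\<close> is dense in \<open>H\<close>, so its products with the
      countably many coset representatives form a countable dense subset of \<open>G\<close>.
      Translating a base of \<open>U\<close> by this set will give a base of
      \<open>T\<close>.\<close>
    define E where "E = (\<lambda>(s, C). s \<otimes> r C) ` (S \<times> rcosets H)"
    have E: "countable E" "E \<subseteq> carrier G"
      using S ctbl r subgroup.subset[OF S(1)] by (auto simp: E_def)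
    obtain B where B: "countable B" "\<And>V. V \<in> B \<Longrightarrow> openin (subtopology T U) V"
      "\<And>W x. openin (subtopology T U) W \<Longrightarrow> x \<in> W \<Longrightarrow> \<exists>V\<in>B. x \<in> V \<and> V \<subseteq> W"
      using U(3) unfolding second_countable_def by metis
    have B_open: "openin T V" "V \<subseteq> U" if "V \<in> B" for V
      using B(2)[OF that] U(1) by (auto simp: openin_open_subtopology)
    define \<B> where "\<B> = (\<lambda>(V, e). V #> e) ` (B \<times> E)"
    have "countable \<B>" using B E by (auto simp: \<B>_def)
    moreover have "openin T V" if "V \<in> \<B>" for V
      using that B_open openin_r_coset E by (auto simp: \<B>_def)
    moreover have "\<exists>V\<in>\<B>. x \<in> V \<and> V \<subseteq> W" if W: "openin T W" "x \<in> W" for W x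
    proof -
      have x: "x \<in> carrier G" using W openin_subset by fastforce
      define C where "C = H #> x"
      have C: "C \<in> rcosets H" using x subgroup.subset[OF H] rcosetsI by (simp add: C_def)
      \<comment> \<open>With \<open>x = h \<otimes> r C\<close>, density of \<open>S\<close> in
        \<open>H\<close> provides \<open>s\<close> close enough to \<open>h\<close> that
        \<open>h \<otimes> inv s \<in> U\<close>. Then \<open>x\<close> lies in the translate of
        \<open>U\<close> by \<open>e = s \<otimes> r C\<close>.\<close>
      define h where "h = x \<otimes> inv (r C)"
      have rC: "r C \<in> carrier G" "H #> x = H #> r C" using r[OF C] by (auto simp: C_def)
      have h: "h \<in> H" "h \<in> carrier G" "x = h \<otimes> r C"
        using rcos_eq_iff[OF H x rC(1)] rC x by (auto simp: h_def m_assoc)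
      define O' where "O' = {y \<in> topspace T. h \<otimes> inv y \<in> U}"
      have "openin T O'" unfolding O'_def
        using U h
        by (intro openin_continuous_map_preimage[where Y = T] continuous_map_mult continuous_map_inv)
          (auto simp: continuous_map_id[unfolded id_def])
      moreover have "h \<in> O'" using h U by (simp add: O'_def)
      ultimately have "O' \<inter> S \<noteq> {}"
        using h(1) openin_Int_closure_of_eq_empty unfolding H_def by blast
      then obtain s where s: "s \<in> S" "h \<otimes> inv s \<in> U" by (auto simp: O'_def)
      define e where "e = s \<otimes> r C"
      have sG: "s \<in> carrier G" using s(1) subgroup.subset[OF S(1)] by blast
      have "e \<in> E"
        unfolding E_def e_def using s(1) C by (intro image_eqI[of _ _ "(s, C)"]) simp_all
      moreover have "e \<in> carrier G" using sG rC(1) by (simp add: e_def)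
      ultimately have e: "e \<in> E" "e \<in> carrier G" .
      have xe: "x = (h \<otimes> inv s) \<otimes> e"
      proof -
        have "inv s \<otimes> (s \<otimes> r C) = r C" using sG rC by (simp add: m_assoc[symmetric])
        then show ?thesis using h sG rC by (simp add: e_def m_assoc)
      qed
      \<comment> \<open>\<open>W\<close> is moved back into \<open>U\<close> by
        \<open>inv e\<close>; a base set of \<open>U\<close> is chosen there and translated forward
        again.\<close>
      have "openin T {y \<in> topspace T. y \<otimes> e \<in> W}"
        using W e
        by (intro openin_continuous_map_preimage[where Y = T] continuous_map_mult)
          (auto simp: continuous_map_id[unfolded id_def])
      then have "openin (subtopology T U) (U \<inter> {y \<in> topspace T. y \<otimes> e \<in> W})"
        by (rule openin_subtopology_Int2)
      moreover have "h \<otimes> inv s \<in> U \<inter> {y \<in> topspace T. y \<otimes> e \<in> W}"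
        using s W h sG xe by auto
      ultimately obtain V where V: "V \<in> B" "h \<otimes> inv s \<in> V" "V \<subseteq> U \<inter> {y \<in> topspace T. y \<otimes> e \<in> W}"
        using B(3) by blast
      then have "x \<in> V #> e" "V #> e \<subseteq> W"
        using xe by (auto simp: r_coset_def)
      then show ?thesis using V e by (auto simp: \<B>_def)
    qed
    ultimately show ?thesis unfolding second_countable_def by blast
  qed
  then show thesis using that H H_open by blast
qed

end

section \<open>Quotients of pro-Lie groups\<close>

text \<open>The domain of a chart around \<open>x\<close> is homeomorphic to a subspace of a
  Euclidean space, which is second countable.\<close>

lemma Lie_group_locally_second_countable:
  assumes "Lie_group G T" "x \<in> topspace T"
  obtains U where "openin T U" "x \<in> U" "second_countable (subtopology T U)"
proof -
  obtain n A where "smooth_atlas n T A"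
    using assms(1) unfolding Lie_group_def by blast
  then have charts: "\<forall>c\<in>A. is_chart n T c" and cover: "(\<Union>c\<in>A. fst c) = topspace T"
    by (auto simp: smooth_atlas_def)
  have "x \<in> (\<Union>c\<in>A. fst c)" using assms(2) cover by simp
  then obtain c where c: "c \<in> A" "x \<in> fst c" by blast
  obtain U \<phi> where c_eq: "c = (U, \<phi>)" by fastforce
  have chart: "openin T U" 
    "homeomorphic_map (subtopology T U) (subtopology (Euclidean_space n) (\<phi> ` U)) \<phi>"
    using charts c(1) c_eq by (auto simp: is_chart_def)
  have "second_countable (subtopology (Euclidean_space n) (\<phi> ` U))"
    by (intro second_countable_subtopology second_countable_Euclidean_space)
  then have "second_countable (subtopology T U)"
    using chart(2) homeomorphic_map_imp_homeomorphic_space homeomorphic_space_second_countability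
    by blast
  then show thesis using that chart(1) c(2) c_eq by simp
qed

text \<open>An ultrafilter contains a coset of each \<open>N\<close> of finite index, hence is Cauchy.\<close>

lemma (in top_group) compact_space_if_complete_linear_precompact:
  assumes complete: "complete_topological_group G T"
    and base: "\<And>U. openin T U \<Longrightarrow> \<one> \<in> U \<Longrightarrow> \<exists>N. N \<lhd> G \<and> N \<subseteq> U \<and> finite (rcosets N)"
  shows "compact_space T"
  unfolding compact_space_fip
proof (intro allI impI, elim conjE)
  fix \<C> assume closed: "\<forall>C\<in>\<C>. closedin T C"
    and fip: "\<forall>\<F>. finite \<F> \<and> \<F> \<subseteq> \<C> \<longrightarrow> \<Inter>\<F> \<noteq> {}"
  \<comment> \<open>Adding the carrier makes the filter concentrate on \<open>G\<close>, as a Cauchy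
    filter must. The finite intersection property makes the filter generated by \<open>\<D>\<close>
    proper.\<close>
  define \<D> where "\<D> = insert (carrier G) \<C>"
  have closed': "\<forall>C\<in>\<D>. closedin T C"
    using closed by (metis \<D>_def closedin_topspace insert_iff topspace_eq)
  have "(INF C\<in>\<D>. principal C) \<noteq> bot"
  proof (rule INF_filter_not_bot)
    fix X assume X: "X \<subseteq> \<D>" "finite X"
    have "carrier G \<inter> \<Inter>(X \<inter> \<C>) \<noteq> {}"
    proof (cases "X \<inter> \<C> = {}")
      case False
      then obtain C where "C \<in> X \<inter> \<C>" by blast
      then have "\<Inter>(X \<inter> \<C>) \<subseteq> carrier G"
        using closed closedin_subset by fastforce
      then show ?thesis using fip X(2) by (metis Int_absorb1 Int_lower2 finite_Int)
    qed (use one_closed in auto)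
    then obtain y where "y \<in> carrier G" "y \<in> \<Inter>(X \<inter> \<C>)" by blast
    then have "y \<in> \<Inter>X" using X(1) unfolding \<D>_def by blast
    then have "\<Inter>X \<noteq> {}" by blast
    then show "(INF C\<in>X. principal C) \<noteq> bot"
      using X(2) by (simp add: INF_principal_finite principal_eq_bot_iff)
  qed
  then obtain F where F: "F \<le> (INF C\<in>\<D>. principal C)" "F \<noteq> bot"
    and ultra: "\<And>P. eventually P F \<or> eventually (\<lambda>x. \<not> P x) F"
    using exists_ultrafilter by metis
  have F_C: "\<forall>\<^sub>F x in F. x \<in> C" if "C \<in> \<D>" for C
    using order_trans[OF F(1) INF_lower[OF that]] by (simp add: le_principal)
  have F_carrier: "\<forall>\<^sub>F x in F. x \<in> carrier G"
    using F_C[of "carrier G"] by (simp add: \<D>_def)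
  have "left_Cauchy_filter G T F"
    unfolding left_Cauchy_filter_def
  proof (intro conjI allI impI F(2) F_carrier)
    fix U assume U: "openin T U \<and> \<one> \<in> U"
    then obtain N where N: "N \<lhd> G" "N \<subseteq> U" "finite (rcosets N)" using base by blast
    interpret N: normal N G by (rule N(1))
    \<comment> \<open>Otherwise the ultrafilter would avoid each of the finitely many cosets, hence
      their union, the whole group.\<close>
    have "\<exists>C\<in>rcosets N. \<forall>\<^sub>F x in F. x \<in> C"
    proof (rule ccontr)
      assume "\<not> ?thesis"
      then have "\<forall>C\<in>rcosets N. \<forall>\<^sub>F x in F. x \<notin> C" using ultra by blast
      then have "\<forall>\<^sub>F x in F. \<forall>C\<in>rcosets N. x \<notin> C"
        using N(3) by (simp add: eventually_ball_finite)
      with F_carrier have "\<forall>\<^sub>F x in F. False"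
        by eventually_elim (use rcosets_part_G[OF N.subgroup_axioms] in blast)
      then show False using F(2) by (simp add: trivial_limit_def)
    qed
    then obtain a where a: "a \<in> carrier G" "\<forall>\<^sub>F x in F. x \<in> N #> a"
      by (auto simp: RCOSETS_def)
    have "inv x \<otimes> y \<in> U" if xy: "x \<in> N #> a" "y \<in> N #> a" for x y
    proof -
      have G: "x \<in> carrier G" "y \<in> carrier G"
        using xy a N.subset r_coset_subset_G by blast+
      have "N #> x = N #> y"
        using repr_independence[OF xy(1) a(1) N.subgroup_axioms]
          repr_independence[OF xy(2) a(1) N.subgroup_axioms] by simp
      \<comment> \<open>The left uniformity involves \<open>inv x \<otimes> y\<close>, so the common
        right coset is turned into a left coset by normality.\<close>
      then have "x <# N = y <# N" using N.coset_eq G by simp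
      moreover have "y \<in> y <# N"
        using G N.one_closed unfolding l_coset_def by (auto intro!: bexI[of _ \<one>])
      ultimately have "y \<in> x <# N" by simp
      then obtain n where n: "n \<in> N" "y = x \<otimes> n" by (auto simp: l_coset_def)
      then have "n \<in> carrier G" by (simp add: N.mem_carrier)
      then have "inv x \<otimes> y = n"
        using G n by (simp add: m_assoc[symmetric])
      then show ?thesis using n N(2) by blast
    qed
    then show "\<forall>\<^sub>F (x, y) in F \<times>\<^sub>F F. inv x \<otimes> y \<in> U"
      using a(2) unfolding eventually_prod_filter
      by (intro exI[of _ "\<lambda>x. x \<in> N #> a"]) auto
  qed
  then obtain l where l: "limitin T (\<lambda>x. x) l F"
    using complete unfolding complete_topological_group_def by blast
  \<comment> \<open>The filter concentrates on the closed set \<open>C\<close>, so its limit cannot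
    lie in the open complement.\<close>
  have "l \<in> C" if C: "C \<in> \<C>" for C
  proof (rule ccontr)
    assume "l \<notin> C"
    then have "openin T (topspace T - C)" "l \<in> topspace T - C"
      using closed C limitin_topspace[OF l] by (simp_all add: openin_diff del: topspace_eq)
    then have "\<forall>\<^sub>F x in F. x \<in> topspace T - C" by (rule limitinD[OF l])
    moreover have "\<forall>\<^sub>F x in F. x \<in> C" using F_C C by (simp add: \<D>_def)
    ultimately have "\<forall>\<^sub>F x in F. False" by eventually_elim simp
    then show False using F(2) by (simp add: trivial_limit_def)
  qed
  then show "\<Inter>\<C> \<noteq> {}" by blast
qed

text \<open>Cosets of \<open>N k\<close> are unions of cosets of the intersection, so their images
  are open in the quotient. They separate points, since distinct points already differ modulo some
  \<open>N k\<close>. There are finitely many for each \<open>k\<close>, and compactness makes them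
  a base.\<close>

lemma (in top_group) compact_quotient_second_countable:
  fixes N :: "nat \<Rightarrow> 'a set"
  assumes compact: "compact_space T"
    and N: "\<And>k. N k \<lhd> G" "\<And>k. openin T (N k)" "decseq N"
    and fin: "\<And>k. finite (rcosets (N k))"
  defines "Q \<equiv> quotient_group_topology G T (\<Inter>k. N k)"
  shows "compact_space Q" "Hausdorff_space Q" "second_countable Q"
proof -
  define M where "M = (\<Inter>k. N k)"
  have sub: "subgroup (N k) G" for k using N(1) by (simp add: normal_imp_subgroup)
  have M: "subgroup M G"
    unfolding M_def by (rule subgroups_Inter) (use sub in auto)
  define q where "q = (\<lambda>x. M #> x)"
  have qmap: "quotient_map T Q q"
    unfolding Q_def q_def M_def quotient_group_topology_def by (rule quotient_map_final_topology)
  have openQ: "openin Q V \<longleftrightarrow> V \<subseteq> q ` carrier G \<and> openin T {x \<in> carrier G. q x \<in> V}" for V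
    by (simp add: Q_def q_def M_def quotient_group_topology_def openin_final_topology)
  have topQ: "topspace Q = q ` carrier G"
    by (simp add: Q_def q_def M_def quotient_group_topology_def topspace_final_topology)
  show "compact_space Q"
    using image_compactin[OF compact[unfolded compact_space_def] quotient_imp_continuous_map[OF qmap]] topQ
    by (simp add: compact_space_def)
  have q_eq: "q x = q y \<longleftrightarrow> x \<otimes> inv y \<in> M" if "x \<in> carrier G" "y \<in> carrier G" for x y
    using rcos_eq_iff[OF M that] by (simp add: q_def)
  have cos: "y \<in> N k #> x \<longleftrightarrow> y \<otimes> inv x \<in> N k" if "x \<in> carrier G" "y \<in> carrier G" for x y k
    using subgroup.rcos_module[OF sub is_group that] .
  have cosG: "N k #> x \<subseteq> carrier G" if "x \<in> carrier G" for x k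
    using r_coset_subset_G[OF subgroup.subset[OF sub] that] .
  \<comment> \<open>\<open>N k #> x\<close> is saturated for \<open>q\<close>: elements with the
    same image differ by an element of \<open>M\<close>, which lies in \<open>N k\<close>.\<close>
  have sat: "y \<in> N k #> x" if "x \<in> carrier G" "y \<in> carrier G" "q y \<in> q ` (N k #> x)" for x y k
  proof -
    from that(3) obtain z where z: "z \<in> N k #> x" "q y = q z" by blast
    have zG: "z \<in> carrier G" using z cosG that(1) by blast
    have "y \<otimes> inv z \<in> N k" using q_eq[OF that(2) zG] z(2) by (auto simp: M_def)
    moreover have "z \<otimes> inv x \<in> N k" using cos[OF that(1) zG] z(1) by simp
    ultimately have "(y \<otimes> inv z) \<otimes> (z \<otimes> inv x) \<in> N k" using sub subgroup.m_closed by metis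
    moreover have "(y \<otimes> inv z) \<otimes> (z \<otimes> inv x) = y \<otimes> inv x"
    proof -
      have "inv z \<otimes> (z \<otimes> inv x) = inv x" using zG that by (simp add: m_assoc[symmetric])
      then show ?thesis using zG that by (simp add: m_assoc)
    qed
    ultimately show ?thesis using cos[OF that(1,2)] by simp
  qed
  have open_q: "openin Q (q ` (N k #> x))" if "x \<in> carrier G" for x k
  proof -
    have "{y \<in> carrier G. q y \<in> q ` (N k #> x)} = N k #> x"
      using sat[OF that] cosG[OF that] by auto
    then show ?thesis
      unfolding openQ using openin_r_coset[OF N(2) that] cosG[OF that] by auto
  qed
  have self: "x \<in> N k #> x" if "x \<in> carrier G" for x k
    using rcos_self[OF that sub] .
  show "Hausdorff_space Q"
    unfolding Hausdorff_space_def topQ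
  proof (intro allI impI, elim conjE imageE)
    fix X Y x y assume xy: "X \<noteq> Y" "X = q x" "x \<in> carrier G" "Y = q y" "y \<in> carrier G"
    then have "x \<otimes> inv y \<notin> M" using q_eq by blast
    then obtain k where k: "x \<otimes> inv y \<notin> N k" by (auto simp: M_def)
    have "disjnt (q ` (N k #> x)) (q ` (N k #> y))"
    proof (rule ccontr)
      assume "\<not> ?thesis"
      then obtain z where z: "z \<in> N k #> x" "q z \<in> q ` (N k #> y)"
        by (auto simp: disjnt_iff)
      then have "z \<in> N k #> y" using sat xy cosG by blast
      then have "N k #> x = N k #> y"
        using repr_independence z(1) xy sub by metis
      then show False using k rcos_eq_iff[OF sub] xy by blast
    qed
    then show "\<exists>U V. openin Q U \<and> openin Q V \<and> X \<in> U \<and> Y \<in> V \<and> disjnt U V"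
      using open_q[OF xy(3)] open_q[OF xy(5)] self[OF xy(3)] self[OF xy(5)] xy(2,4)
      by (intro exI[of _ "q ` (N k #> x)"] exI[of _ "q ` (N k #> y)"]) simp
  qed
  define \<B> where "\<B> = (\<Union>k. (\<lambda>C. q ` C) ` (rcosets (N k)))"
  have "countable \<B>"
    unfolding \<B>_def using fin by (auto intro: countable_finite)
  moreover have "openin Q V" if "V \<in> \<B>" for V
    using that open_q by (auto simp: \<B>_def RCOSETS_def)
  moreover have "\<exists>V\<in>\<B>. X \<in> V \<and> V \<subseteq> W" if W: "openin Q W" "X \<in> W" for W X
  proof -
    obtain x where x: "x \<in> carrier G" "X = q x"
      using W openQ by blast
    define P where "P = {y \<in> carrier G. q y \<in> W}"
    have P: "openin T P" using W openQ by (simp add: P_def)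
    have "\<exists>k. N k #> x \<subseteq> P"
    proof (rule ccontr)
      assume no: "\<not> ?thesis"
      \<comment> \<open>These nested nonempty closed sets have a common point by compactness. It
        lies in \<open>M #> x\<close> but outside \<open>P\<close>, although \<open>P\<close> is the
        full preimage of a set containing \<open>q x\<close>.\<close>
      have "(\<Inter>k. (N k #> x) - P) \<noteq> {}"
      proof (rule compact_space_imp_nest[OF compact])
        show "closedin T ((N k #> x) - P)" for k
          using closedin_r_coset[OF sub closedin_open_subgroup[OF sub N(2)] x(1)] P
          by (rule closedin_diff)
        show "(N k #> x) - P \<noteq> {}" for k using no by blast
        show "decseq (\<lambda>k. (N k #> x) - P)"
          using N(3) by (fastforce simp: decseq_def r_coset_def)
      qed
      then obtain y where y: "\<And>k. y \<in> N k #> x" "y \<notin> P" by blast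
      have yG: "y \<in> carrier G" using y(1) cosG x(1) by blast
      have "y \<otimes> inv x \<in> M" using y(1) cos[OF x(1) yG] by (simp add: M_def)
      then have "q y = q x" using q_eq yG x(1) by blast
      then show False using y(2) yG W x by (simp add: P_def)
    qed
    then obtain k where "N k #> x \<subseteq> P" by blast
    then have "q ` (N k #> x) \<subseteq> W" "X \<in> q ` (N k #> x)"
      using x self by (auto simp: P_def)
    moreover have "q ` (N k #> x) \<in> \<B>"
      using x(1) by (auto simp: \<B>_def RCOSETS_def)
    ultimately show ?thesis by blast
  qed
  ultimately show "second_countable Q"
    unfolding second_countable_def by (intro exI[of _ \<B>]) simp
qed

text \<open>Elements \<open>x k\<close> of \<open>N k\<close> outside \<open>N (Suc k)\<close> have
  distinct cosets. For \<open>j < k\<close> the element \<open>x k\<close> lies in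
  \<open>N (Suc j)\<close>, so equality of the cosets of \<open>x j\<close> and \<open>x k\<close>
  would put \<open>x j\<close> into \<open>N (Suc j)\<close> as well.\<close>

lemma (in group) infinite_rcosets_Inter_strict:
  fixes N :: "nat \<Rightarrow> 'a set"
  assumes "\<And>k. subgroup (N k) G" "\<And>k. N (Suc k) \<subset> N k"
  shows "infinite (rcosets (\<Inter>k. N k))"
proof -
  define M where "M = (\<Inter>k. N k)"
  have M: "subgroup M G"
    unfolding M_def by (rule subgroups_Inter) (use assms in auto)
  have dec: "N k \<subseteq> N j" if "j \<le> k" for j k
    by (rule lift_Suc_antimono_le[of N, OF psubset_imp_subset[OF assms(2)] that])
  have "\<exists>y. y \<in> N k - N (Suc k)" for k
    by (rule psubset_imp_ex_mem[OF assms(2)])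
  then obtain x where x: "\<And>k. x k \<in> N k" "\<And>k. x k \<notin> N (Suc k)"
    by (metis DiffD1 DiffD2)
  have xG: "x k \<in> carrier G" for k using x(1) subgroup.subset[OF assms(1)] by blast
  have ne: "M #> x j \<noteq> M #> x k" if "j < k" for j k
  proof
    assume "M #> x j = M #> x k"
    then have "x j \<otimes> inv (x k) \<in> N (Suc j)"
      using rcos_eq_iff[OF M xG xG] by (auto simp: M_def)
    moreover have "x k \<in> N (Suc j)" using x(1) dec[of "Suc j" k] that by auto
    ultimately have "(x j \<otimes> inv (x k)) \<otimes> x k \<in> N (Suc j)"
      using assms(1) subgroup.m_closed by metis
    then show False using x(2) xG by (simp add: m_assoc)
  qed
  have "inj (\<lambda>k. M #> x k)"
    by (rule injI) (metis ne linorder_neqE_nat)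
  then have "infinite (range (\<lambda>k. M #> x k))"
    by (rule range_inj_infinite)
  moreover have "range (\<lambda>k. M #> x k) \<subseteq> rcosets M"
    using xG subgroup.subset[OF M] rcosetsI by blast
  ultimately show ?thesis
    unfolding M_def using infinite_super by blast
qed

text \<open>Turns a countable discrete quotient of \<open>G Mod N\<close> into a quotient of
  \<open>G\<close> itself: the kernel \<open>K\<close> of the composite onto \<open>E\<close> is the
  preimage of an open set, so \<open>G Mod K\<close> is discrete, and countable discrete spaces are
  separable and metrizable.\<close>

lemma (in top_group) pullback_discrete_quotient:
  assumes "N \<lhd> G" "group_hom (G Mod N) E f" "f ` carrier (G Mod N) = carrier E"
    and "openin (quotient_group_topology G T N) (kernel (G Mod N) E f)"
    and "countable (carrier E)" "infinite (carrier E)"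
  obtains K where "K \<lhd> G" "closedin T K" "infinite (carrier (G Mod K))"
    "separable_space (quotient_group_topology G T K)"
    "metrizable_space (quotient_group_topology G T K)"
proof -
  interpret N: normal N G by (rule assms(1))
  interpret f: group_hom "G Mod N" E f by (rule assms(2))
  define \<psi> where "\<psi> = (\<lambda>x. f (N #> x))"
  have "\<psi> \<in> hom G E"
    using Group.hom_compose[OF N.r_coset_hom_Mod f.homh] by (simp add: \<psi>_def o_def)
  then interpret \<psi>: group_hom G E \<psi>
    by (simp add: group_hom_def group_hom_axioms_def)
  have carrier_Mod: "carrier (G Mod N) = (\<lambda>x. N #> x) ` carrier G"
    by (auto simp: FactGroup_def RCOSETS_def)
  then have "\<psi> ` carrier G = carrier E"
    using assms(3) by (simp add: \<psi>_def image_image)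
  \<comment> \<open>The first isomorphism theorem transfers countability and infinity from
    \<open>E\<close> to \<open>G Mod K\<close>.\<close>
  then have bij: "bij_betw (\<lambda>X. the_elem (\<psi> ` X)) (carrier (G Mod kernel G E \<psi>)) (carrier E)"
    using \<psi>.FactGroup_iso_set by (simp add: iso_def)
  define K where "K = kernel G E \<psi>"
  have K: "K \<lhd> G" unfolding K_def by (rule \<psi>.normal_kernel)
  have count: "countable (carrier (G Mod K))" "infinite (carrier (G Mod K))"
    using bij assms(5,6) bij_betw_finite[OF bij] countable_image_inj_on
    unfolding K_def bij_betw_def by metis+
  have "K = {x \<in> carrier G. N #> x \<in> kernel (G Mod N) E f}"
    using carrier_Mod by (auto simp: K_def kernel_def \<psi>_def)
  then have K_open: "openin T K"
    using assms(4) by (simp add: quotient_group_topology_def openin_final_topology)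
  have "closedin T K"
    using closedin_open_subgroup K_open K normal_imp_subgroup by blast
  then show thesis
    using that K count discrete_quotient[OF K K_open]
    by (simp add: separable_space_discrete_topology)
qed

section \<open>The two cases: an infinite Lie quotient, or only finite ones\<close>

theorem theorem2p15:
  fixes G :: "('a, 'b) monoid_scheme" and T :: "'a topology"
  assumes "comm_group G"
    and "infinite (carrier G)"
    and "pro_Lie_group G T"
  shows "\<exists>N. N \<lhd> G \<and> closedin T N \<and>
           infinite (carrier (G Mod N)) \<and>
           separable_space (quotient_group_topology G T N) \<and>
           metrizable_space (quotient_group_topology G T N)"
proof -
  have complete: "complete_topological_group G T"
    and small: "\<And>U. openin T U \<Longrightarrow> \<one>\<^bsub>G\<^esub> \<in> U \<Longrightarrow> \<exists>N. N \<subseteq> U \<and> N \<lhd> G \<and> closedin T N \<and>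
          Lie_group (G Mod N) (quotient_group_topology G T N)"
    using assms(3) unfolding pro_Lie_group_def by blast+
  interpret G: comm_group G by (rule assms(1))
  interpret G: top_group G T
    using complete by (simp add: top_group_def complete_topological_group_def)
  have carrier_Mod: "carrier (G Mod N) = rcosets\<^bsub>G\<^esub> N" for N
    by (simp add: FactGroup_def)
  show ?thesis
  proof (cases "\<exists>N. N \<lhd> G \<and> closedin T N \<and> infinite (carrier (G Mod N)) \<and>
      Lie_group (G Mod N) (quotient_group_topology G T N)")
    case True
    then obtain N where N: "N \<lhd> G" "closedin T N" "infinite (carrier (G Mod N))"
      and Lie: "Lie_group (G Mod N) (quotient_group_topology G T N)" by blast
    define L where "L = G Mod N"
    define Q where "Q = quotient_group_topology G T N"
    interpret L: comm_group L
      unfolding L_def using N(1) G.abelian_FactGroup normal_imp_subgroup by blast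
    interpret L: top_group L Q
      using Lie by (simp add: top_group_def Lie_group_def L_def Q_def)
    obtain U where "openin Q U" "\<one>\<^bsub>L\<^esub> \<in> U" "second_countable (subtopology Q U)"
      using Lie_group_locally_second_countable[of L Q "\<one>\<^bsub>L\<^esub>"] Lie
      by (auto simp: L_def[symmetric] Q_def[symmetric])
    then obtain H where H: "subgroup H L" "openin Q H"
      and sc: "countable (rcosets\<^bsub>L\<^esub> H) \<Longrightarrow> second_countable Q"
      using L.open_subgroup_second_countable by metis
    show ?thesis
    \<comment> \<open>A countably infinite index is treated together with the uncountable ones,
      through a countably infinite quotient of \<open>L Mod H\<close>.\<close>
    proof (cases "finite (rcosets\<^bsub>L\<^esub> H)")
      case True
      then have "second_countable Q" using sc countable_finite by blast
      then have "separable_space Q" "metrizable_space Q"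
        using second_countable_imp_separable_space Urysohn_metrization L.regular L.Hausdorff
        by blast+
      then show ?thesis using N unfolding Q_def by blast
    next
      case False
      then have "infinite (carrier (L Mod H))" by (simp add: FactGroup_def)
      interpret A: comm_group "L Mod H" by (rule L.abelian_FactGroup[OF H(1)])
      obtain K where K: "subgroup K (L Mod H)"
        "countable (carrier (L Mod H Mod K))" "infinite (carrier (L Mod H Mod K))"
        using A.countably_infinite_quotient[OF \<open>infinite (carrier (L Mod H))\<close>] by blast
      interpret H: normal H L using H(1) L.subgroup_imp_normal by blast
      interpret K: normal K "L Mod H" using K(1) A.subgroup_imp_normal by blast
      \<comment> \<open>\<open>f\<close> is the composite of the two projections from
        \<open>L\<close> to \<open>L Mod H Mod K\<close>. Its kernel contains the open subgroup
        \<open>H\<close> and is therefore open.\<close>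
      define f where "f = (\<lambda>x. K #>\<^bsub>L Mod H\<^esub> (H #>\<^bsub>L\<^esub> x))"
      have "f \<in> hom L (L Mod H Mod K)"
        using hom_compose[OF H.r_coset_hom_Mod K.r_coset_hom_Mod] by (simp add: f_def o_def)
      then interpret f: group_hom L "L Mod H Mod K" f
        using K.factorgroup_is_group by (simp add: group_hom_def group_hom_axioms_def)
      have "f ` carrier L = carrier (L Mod H Mod K)"
        by (auto simp: f_def FactGroup_def RCOSETS_def)
      moreover have "H \<subseteq> kernel L (L Mod H Mod K) f"
      proof
        fix h assume h: "h \<in> H"
        then have "H #>\<^bsub>L\<^esub> h = \<one>\<^bsub>L Mod H\<^esub>"
          using H.rcos_const by (simp add: L.is_group)
        \<comment> \<open>The identity of the quotient by \<open>K\<close> is the set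
          \<open>K\<close> itself.\<close>
        then have "f h = K"
          using K.one_closed K.rcos_const by (simp add: f_def)
        then show "h \<in> kernel L (L Mod H Mod K) f"
          using h H.subset by (auto simp: kernel_def)
      qed
      then have "openin Q (kernel L (L Mod H Mod K) f)"
        using L.openin_subgroup[OF f.subgroup_kernel H(2) H.one_closed] by blast
      ultimately show ?thesis
        using G.pullback_discrete_quotient[OF N(1), of "L Mod H Mod K" f] K(2,3)
          f.group_hom_axioms
        unfolding L_def Q_def by metis
    qed
  next
    case False
    \<comment> \<open>Every Lie quotient is finite in this case, so the small closed subgroups have
      finite index and are open.\<close>
    have base: "\<exists>N. N \<lhd> G \<and> openin T N \<and> N \<subseteq> U \<and> finite (rcosets\<^bsub>G\<^esub> N)"
      if "openin T U" "\<one>\<^bsub>G\<^esub> \<in> U" for U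
    proof -
      from small[OF that]
      obtain N where N: "N \<subseteq> U" "N \<lhd> G" "closedin T N" "finite (rcosets\<^bsub>G\<^esub> N)"
        using False carrier_Mod by metis
      then have "openin T N"
        using G.openin_finite_index_subgroup normal_imp_subgroup by blast
      then show ?thesis using N by blast
    qed
    have compact: "compact_space T"
      using G.compact_space_if_complete_linear_precompact[OF complete] base by meson
    define P where "P = (\<lambda>M. M \<lhd> G \<and> openin T M \<and> finite (rcosets\<^bsub>G\<^esub> M))"
    have "\<exists>N. \<forall>k. P (N k) \<and> N (Suc k) \<subset> N k"
    proof (rule dependent_nat_choice)
      have "openin T (carrier G)" by (metis G.topspace_eq openin_topspace)
      then show "\<exists>M. P M" using base[of "carrier G"] by (auto simp: P_def)
    next
      fix M and k :: nat assume M: "P M"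
      then have sub: "subgroup M G" by (simp add: P_def normal_imp_subgroup)
      \<comment> \<open>Otherwise finitely many finite cosets would cover the infinite group
        \<open>G\<close>.\<close>
      have "infinite M"
      proof
        assume fin: "finite M"
        have "finite C" if "C \<in> rcosets\<^bsub>G\<^esub> M" for C
          using that fin by (auto simp: RCOSETS_def r_coset_def)
        then have "finite (carrier G)"
          using M G.rcosets_part_G[OF sub] finite_Union by (metis P_def)
        then show False using assms(2) by simp
      qed
      then obtain x where x: "x \<in> M" "x \<noteq> \<one>\<^bsub>G\<^esub>"
        by (metis finite.emptyI finite_insert finite_subset insertI1 subsetI)
      \<comment> \<open>Removing \<open>x\<close> from \<open>M\<close> leaves an open neighbourhood
        of the identity; a subgroup from the base inside it is strictly smaller than
        \<open>M\<close>.\<close>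
      have "closedin T {x}"
        using subgroup.mem_carrier[OF sub x(1)] G.Hausdorff
        by (simp add: closedin_Hausdorff_singleton)
      then have "openin T (M - {x})" using M by (simp add: P_def openin_diff)
      moreover have "\<one>\<^bsub>G\<^esub> \<in> M - {x}" using x(2) subgroup.one_closed[OF sub] by blast
      ultimately obtain N where "N \<lhd> G" "openin T N" "N \<subseteq> M - {x}" "finite (rcosets\<^bsub>G\<^esub> N)"
        using base[of "M - {x}"] by blast
      then show "\<exists>N. P N \<and> N \<subset> M" using x(1) by (auto simp: P_def)
    qed
    then obtain N where PN: "\<forall>k. P (N k) \<and> N (Suc k) \<subset> N k" ..
    then have N: "N k \<lhd> G" "openin T (N k)" "finite (rcosets\<^bsub>G\<^esub> (N k))" "N (Suc k) \<subset> N k" for k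
      by (simp_all add: P_def)
    define M where "M = (\<Inter>k. N k)"
    have sub: "subgroup (N k) G" for k by (rule normal_imp_subgroup[OF N(1)])
    have "subgroup M G"
      unfolding M_def using sub by (intro G.subgroups_Inter) auto
    then have "M \<lhd> G" by (rule G.subgroup_imp_normal)
    moreover have "closedin T M"
      unfolding M_def using G.closedin_open_subgroup[OF sub N(2)] by (intro closedin_Inter) auto
    moreover have "infinite (carrier (G Mod M))"
      unfolding carrier_Mod M_def by (rule G.infinite_rcosets_Inter_strict[of N, OF sub N(4)])
    moreover have "decseq N"
      by (rule decseq_SucI[of N, OF psubset_imp_subset[OF N(4)]])
    then have "compact_space (quotient_group_topology G T M)"
      "Hausdorff_space (quotient_group_topology G T M)"
      "second_countable (quotient_group_topology G T M)"
      unfolding M_def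
      using G.compact_quotient_second_countable[of N, OF compact N(1,2) _ N(3)] by blast+
    then have "separable_space (quotient_group_topology G T M)"
      "metrizable_space (quotient_group_topology G T M)"
      by (simp_all add: second_countable_imp_separable_space Urysohn_metrization
          compact_Hausdorff_imp_regular_space)
    ultimately show ?thesis by blast
  qed
qed

end
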